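(* Let $m$ be a positive integer. If $m$ is a power of two, then every angle is $m$-sectable; in other words, the real part $a=\mathrm{Re}(\alpha)$ of an $m$-sectable angle $\alpha$ can assume any value in $[-1,1]$. If $m$ is not a power of two, then an angle $\alpha$ is $m$-sectable only if $a=\mathrm{Re}(\alpha)$ is an algebraic number (lying in $[-1,1]$).
   Context: An "angle" is a complex number $\alpha$ with $|\alpha|=1$ (playing the role of $e^{2\pi i\theta}$), so $\mathrm{Re}(\alpha)$ is its cosine. Given a set $S\subseteq\mathbb{C}$ containing $0$ and $1$, a complex number $\beta$ is constructible over $S$ if there is an unmarked straightedge-and-compass construction in the plane $\mathbb{C}$ starting from the points of $S$ and ending with $\beta$. An angle $\alpha$ is $m$-sectable if there exists an angle $\beta$ with $\beta^m=\alpha$ that is constructible over $\{0,1,\alpha\}$ (equivalently, $\mathrm{Re}(\beta)$ is constructible over the field $\mathbb{Q}(\mathrm{Re}(\alpha))$). *)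

theory Defs
  imports "HOL-Analysis.Analysis" "HOL-Computational_Algebra.Polynomial"
begin

definition is_angle :: "complex \<Rightarrow> bool" where
  "is_angle \<alpha> \<longleftrightarrow> cmod \<alpha> = 1"

text \<open>
  A line joins two distinct constructed points; a circle has a constructed centre and as
  radius the distance of two distinct constructed points (non-collapsing compass). New points
  arise only as intersections of two different such curves.
\<close>

inductive_set constructible :: "complex set \<Rightarrow> complex set" for S :: "complex set" where
  base: "x \<in> S \<Longrightarrow> x \<in> constructible S"
| line_line:
    "\<lbrakk>a \<in> constructible S; b \<in> constructible S; a \<noteq> b;
      c \<in> constructible S; d \<in> constructible S; c \<noteq> d;
      affine hull {a, b} \<noteq> affine hull {c, d};
      x \<in> affine hull {a, b}; x \<in> affine hull {c, d}\<rbrakk>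
     \<Longrightarrow> x \<in> constructible S"
| line_circle:
    "\<lbrakk>a \<in> constructible S; b \<in> constructible S; a \<noteq> b;
      c \<in> constructible S; p \<in> constructible S; q \<in> constructible S; p \<noteq> q;
      x \<in> affine hull {a, b}; x \<in> sphere c (dist p q)\<rbrakk>
     \<Longrightarrow> x \<in> constructible S"
| circle_circle:
    "\<lbrakk>c \<in> constructible S; p \<in> constructible S; q \<in> constructible S; p \<noteq> q;
      c' \<in> constructible S; p' \<in> constructible S; q' \<in> constructible S; p' \<noteq> q';
      sphere c (dist p q) \<noteq> sphere c' (dist p' q');
      x \<in> sphere c (dist p q); x \<in> sphere c' (dist p' q')\<rbrakk>
     \<Longrightarrow> x \<in> constructible S"

definition sectable :: "nat \<Rightarrow> complex \<Rightarrow> bool" where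
  "sectable m \<alpha> \<longleftrightarrow>
     (\<exists>\<beta>. is_angle \<beta> \<and> \<beta> ^ m = \<alpha> \<and> \<beta> \<in> constructible {0, 1, \<alpha>})"

end

theory Submission
  imports Defs
begin

text \<open>
  Bisecting an angle needs only the rhombus \<open>0, 1, 1 + \<alpha>, \<alpha>\<close> (and a perpendicular when \<open>\<alpha> = -1\<close>),
  which settles powers of two by iteration. Conversely, every point constructible from
  \<open>0, 1, \<alpha>\<close> lies in a tower of quadratic extensions of \<open>\<rat>(\<alpha>)\<close>. If \<open>m\<close> has an odd divisor
  \<open>p > 1\<close>, an \<open>m\<close>-section yields a \<open>p\<close>-th root of \<open>\<alpha>\<close> in that tower, and taking norms pushes
  the existence of such a root down to \<open>\<rat>(\<alpha>)\<close>. For transcendental \<open>\<alpha>\<close> comparing degrees in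
  \<open>f ^ p = X * g ^ p\<close> shows that there is none, so \<open>\<alpha>\<close> is algebraic. Finally, if \<open>f(\<alpha>) = 0\<close> then
  \<open>f(z) * f(1/z)\<close>, written as a polynomial in \<open>z + 1/z\<close>, annihilates \<open>\<alpha> + 1/\<alpha> = 2 * Re \<alpha>\<close>.
\<close>

section \<open>Subfields and quadratic extensions\<close>

definition is_subfield :: "'a::field set \<Rightarrow> bool" where
  "is_subfield K \<longleftrightarrow> 1 \<in> K \<and> (\<forall>x\<in>K. \<forall>y\<in>K. x - y \<in> K \<and> x * y \<in> K) \<and>
     (\<forall>x\<in>K. inverse x \<in> K)"

context
  fixes K :: "'a::field set"
  assumes K: "is_subfield K"
begin

lemma subfield_1: "1 \<in> K"
  and subfield_diff: "x \<in> K \<Longrightarrow> y \<in> K \<Longrightarrow> x - y \<in> K"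
  and subfield_mult: "x \<in> K \<Longrightarrow> y \<in> K \<Longrightarrow> x * y \<in> K"
  and subfield_inverse: "x \<in> K \<Longrightarrow> inverse x \<in> K"
  using K by (auto simp: is_subfield_def)

lemma subfield_0: "0 \<in> K"
  using subfield_diff[OF subfield_1 subfield_1] by simp

lemma subfield_minus: "x \<in> K \<Longrightarrow> - x \<in> K"
  using subfield_diff[OF subfield_0] by fastforce

lemma subfield_add: "x \<in> K \<Longrightarrow> y \<in> K \<Longrightarrow> x + y \<in> K"
  using subfield_diff[OF _ subfield_minus] by fastforce

lemma subfield_divide: "x \<in> K \<Longrightarrow> y \<in> K \<Longrightarrow> x / y \<in> K"
  by (simp add: divide_inverse subfield_mult subfield_inverse)

lemma subfield_power: "x \<in> K \<Longrightarrow> x ^ n \<in> K"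
  by (induction n) (auto simp: subfield_1 subfield_mult)

lemma subfield_of_nat: "of_nat n \<in> K"
  by (induction n) (auto simp: subfield_0 subfield_1 subfield_add)

lemma subfield_numeral: "numeral n \<in> K"
  using subfield_of_nat[of "numeral n"] by simp

lemmas subfield_closed = subfield_0 subfield_1 subfield_numeral subfield_minus subfield_add
  subfield_diff subfield_mult subfield_inverse subfield_divide subfield_power

end

definition quadratic_extension :: "'a::field set \<Rightarrow> 'a \<Rightarrow> 'a set" where
  "quadratic_extension K s = {x + y * s | x y. x \<in> K \<and> y \<in> K}"

lemma subset_quadratic_extension: "is_subfield K \<Longrightarrow> K \<subseteq> quadratic_extension K s"
  unfolding quadratic_extension_def by (force intro: subfield_closed)

lemma generator_in_quadratic_extension: "is_subfield K \<Longrightarrow> s \<in> quadratic_extension K s"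
  unfolding quadratic_extension_def by (force intro: subfield_closed)

text \<open>Otherwise the relation could be solved for \<open>s\<close> inside \<open>K\<close>.
  Independence of 1 and \<open>s\<close> over \<open>K\<close> is what makes conjugation,
  \<open>x + y * s\<close> to \<open>x - y * s\<close>, meaningful.\<close>

lemma quadratic_basis_unique:
  assumes K: "is_subfield K" and s: "s \<notin> K" and "x \<in> K" "y \<in> K" "x + y * s \<in> K"
  shows "y = 0"
proof (rule ccontr)
  assume "y \<noteq> 0"
  then have "s = (x + y * s - x) / y" by simp
  also have "\<dots> \<in> K" using assms subfield_diff subfield_divide by blast
  finally show False using s by simp
qed

lemma is_subfield_quadratic_extension:
  assumes K: "is_subfield K" and ss: "s * s \<in> K" and s: "s \<notin> K"
  shows "is_subfield (quadratic_extension K s)"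
  unfolding is_subfield_def
proof (intro conjI ballI)
  show "1 \<in> quadratic_extension K s"
    using subset_quadratic_extension[OF K] subfield_1[OF K] by blast
next
  fix u v assume "u \<in> quadratic_extension K s" "v \<in> quadratic_extension K s"
  then obtain x y z w where *: "x \<in> K" "y \<in> K" "z \<in> K" "w \<in> K"
    and u: "u = x + y * s" and v: "v = z + w * s"
    by (auto simp: quadratic_extension_def)
  have "u - v = (x - z) + (y - w) * s" by (simp add: u v algebra_simps)
  then show "u - v \<in> quadratic_extension K s"
    unfolding quadratic_extension_def using * subfield_diff[OF K] by blast
  have "u * v = (x * z + y * w * (s * s)) + (x * w + y * z) * s"
    by (simp add: u v algebra_simps)
  moreover have "x * z + y * w * (s * s) \<in> K" "x * w + y * z \<in> K"
    using * ss by (simp_all add: subfield_closed[OF K])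
  ultimately show "u * v \<in> quadratic_extension K s"
    unfolding quadratic_extension_def by blast
next
  fix u assume "u \<in> quadratic_extension K s"
  then obtain x y where *: "x \<in> K" "y \<in> K" and u: "u = x + y * s"
    by (auto simp: quadratic_extension_def)
  \<comment> \<open>\<open>n\<close> is the norm of \<open>u\<close>; the inverse is the conjugate
    divided by the norm.\<close>
  define n where "n = x * x - y * y * (s * s)"
  have n: "n = (x + y * s) * (x - y * s)" by (simp add: n_def algebra_simps)
  have nK: "n \<in> K" unfolding n_def using * ss by (simp add: subfield_closed[OF K])
  have "inverse u = x / n + (- y / n) * s"
  proof (cases "n = 0")
    \<comment> \<open>A zero norm forces \<open>y = 0\<close> and then \<open>x = 0\<close>; both
      sides are 0 by the conventions for \<open>inverse 0\<close> and division by 0.\<close>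
    case True
    then have "x + y * s = 0 \<or> x + (- y) * s = 0" using n by simp
    then have "y = 0"
      using quadratic_basis_unique[OF K s, of x y] quadratic_basis_unique[OF K s, of x "- y"]
        * subfield_0[OF K] subfield_minus[OF K] by fastforce
    then show ?thesis using True by (simp add: n_def u)
  next
    case False
    then have "u \<noteq> 0" "x - y * s \<noteq> 0" using n u by auto
    have "x / n + (- y / n) * s = (x - y * s) / n"
      by (simp add: diff_divide_distrib)
    also have "\<dots> = inverse u"
      using \<open>x - y * s \<noteq> 0\<close> by (simp add: n u divide_inverse)
    finally show ?thesis ..
  qed
  moreover have "x / n \<in> K" "- y / n \<in> K" using * nK by (simp_all add: subfield_closed[OF K])
  ultimately show "inverse u \<in> quadratic_extension K s"
    unfolding quadratic_extension_def by blast
qed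

text \<open>If \<open>g ^ p = a\<close> in \<open>K(s)\<close> then the norm \<open>N\<close> of \<open>g\<close> satisfies \<open>N ^ p = a\<^sup>2\<close>, so for
  \<open>p = 2 * k + 1\<close> the quotient \<open>a / N ^ k\<close> is a \<open>p\<close>-th root of \<open>a\<close> in \<open>K\<close>.\<close>

lemma odd_root_descends_quadratic_extension:
  assumes K: "is_subfield K" and ss: "s * s \<in> K" and s: "s \<notin> K"
    and a: "a \<in> K" and p: "odd p" and g: "g \<in> quadratic_extension K s" "g ^ p = a"
  shows "\<exists>h\<in>K. h ^ p = a"
proof -
  obtain x y where xy: "x \<in> K" "y \<in> K" and gxy: "g = x + y * s"
    using g by (auto simp: quadratic_extension_def)
  \<comment> \<open>Conjugate elements have conjugate powers. As \<open>g ^ p = a\<close> lies in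
    \<open>K\<close>, its \<open>s\<close>-part \<open>v\<close> vanishes, so the conjugate of
    \<open>g\<close> is also a \<open>p\<close>-th root of \<open>a\<close>.\<close>
  have "\<exists>u\<in>K. \<exists>v\<in>K. (x + y * s) ^ n = u + v * s \<and> (x - y * s) ^ n = u - v * s" for n
  proof (induction n)
    case 0
    show ?case using subfield_0[OF K] subfield_1[OF K] by force
  next
    case (Suc n)
    then obtain u v where uv: "u \<in> K" "v \<in> K"
      "(x + y * s) ^ n = u + v * s" "(x - y * s) ^ n = u - v * s" by blast
    show ?case
    proof (intro bexI conjI)
      show "x * v + y * u \<in> K" "x * u + y * v * (s * s) \<in> K"
        using xy uv ss by (simp_all add: subfield_closed[OF K])
    qed (unfold power_Suc uv(3,4), simp_all add: algebra_simps)
  qed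
  then obtain u v where uv: "u \<in> K" "v \<in> K"
    "(x + y * s) ^ p = u + v * s" "(x - y * s) ^ p = u - v * s" by blast
  have "v = 0" using quadratic_basis_unique[OF K s uv(1,2)] uv(3) g gxy a by simp
  then have conj: "(x - y * s) ^ p = a" using uv g gxy by simp
  define N where "N = x * x - y * y * (s * s)"
  have NK: "N \<in> K" unfolding N_def using xy ss by (simp add: subfield_closed[OF K])
  have "N = (x + y * s) * (x - y * s)" by (simp add: N_def algebra_simps)
  then have Np: "N ^ p = a * a" using conj g gxy by (simp add: power_mult_distrib)
  obtain k where k: "p = 2 * k + 1" using p by (rule oddE)
  show ?thesis
  \<comment> \<open>The cancellation of \<open>(a * a) ^ k\<close> below supposes \<open>a\<close>
    nonzero; for \<open>a = 0\<close> the root is 0, an odd \<open>p\<close> being positive.\<close>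
  proof (cases "a = 0")
    case True
    then show ?thesis using p subfield_0[OF K] by (auto simp: zero_power odd_pos)
  next
    case False
    have "(a / N ^ k) ^ p = a ^ p / (N ^ p) ^ k"
      by (simp add: power_divide flip: power_mult) (simp add: mult.commute)
    also have "\<dots> = a ^ p / (a * a) ^ k" by (simp only: Np)
    also have "\<dots> = a" using False by (simp add: k power_mult power2_eq_square)
    finally show ?thesis using a NK subfield_divide[OF K] subfield_power[OF K] by blast
  qed
qed

section \<open>Towers of quadratic extensions and their union\<close>

inductive quadratic_tower :: "'a::field set \<Rightarrow> 'a set \<Rightarrow> bool" for F where
  base: "quadratic_tower F F"
| step: "quadratic_tower F K \<Longrightarrow> s * s \<in> K \<Longrightarrow> s \<notin> K \<Longrightarrow>
           quadratic_tower F (quadratic_extension K s)"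

text \<open>For a subfield \<open>F\<close> this is the least subfield above \<open>F\<close> closed
  under square roots. As a union of towers it places each element at the top of finitely many proper
  steps, along which norms can be taken.\<close>

definition quadratic_closure :: "'a::field set \<Rightarrow> 'a set" where
  "quadratic_closure F = \<Union> {K. quadratic_tower F K}"

lemma is_subfield_quadratic_tower:
  assumes "quadratic_tower F K" "is_subfield F"
  shows "is_subfield K"
  using assms by induction (auto intro: is_subfield_quadratic_extension)

lemma subset_quadratic_tower:
  assumes "quadratic_tower F K" "is_subfield F"
  shows "F \<subseteq> K"
  using assms
proof induction
  case (step K s)
  then show ?case
    using subset_quadratic_extension is_subfield_quadratic_tower by blast
qed simp

text \<open>The root moves down one floor at a time. Its value changes on the way, so
  \<open>g\<close> is arbitrary in the induction, while \<open>a\<close> belongs to every floor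
  because \<open>F\<close> is contained in each.\<close>

lemma odd_root_descends_quadratic_tower:
  assumes "quadratic_tower F K" "is_subfield F" "a \<in> F" "odd p" "g \<in> K" "g ^ p = a"
  shows "\<exists>h\<in>F. h ^ p = a"
  using assms
proof (induction arbitrary: g)
  case (step K s)
  have K: "is_subfield K" using step is_subfield_quadratic_tower by blast
  have "F \<subseteq> K" using step subset_quadratic_tower by blast
  then show ?case
    using odd_root_descends_quadratic_extension[OF K] step by blast
qed blast

text \<open>The square roots that build \<open>L\<close> are adjoined to \<open>K\<close> one after
  another, skipping those already present. Any two elements of the union therefore share a tower,
  which makes the union a field.\<close>

lemma quadratic_tower_directed:
  assumes "quadratic_tower F L" "quadratic_tower F K" "is_subfield F"
  shows "\<exists>M. quadratic_tower F M \<and> K \<subseteq> M \<and> L \<subseteq> M"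
  using assms
proof induction
  case base
  then show ?case using subset_quadratic_tower by blast
next
  case (step L s)
  then obtain M where M: "quadratic_tower F M" "K \<subseteq> M" "L \<subseteq> M" by blast
  have subM: "is_subfield M" using M step is_subfield_quadratic_tower by blast
  show ?case
  proof (cases "s \<in> M")
    case True
    then have "quadratic_extension L s \<subseteq> M"
      using M(3) subfield_add[OF subM] subfield_mult[OF subM]
      unfolding quadratic_extension_def by blast
    then show ?thesis using M by blast
  next
    case False
    have "quadratic_extension L s \<subseteq> quadratic_extension M s"
      using M(3) unfolding quadratic_extension_def by blast
    moreover have "quadratic_tower F (quadratic_extension M s)"
      using M step False by (intro quadratic_tower.step) auto
    ultimately show ?thesis using M subset_quadratic_extension[OF subM] by blast
  qed
qed

lemma subset_quadratic_closure: "F \<subseteq> quadratic_closure F"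
  unfolding quadratic_closure_def using quadratic_tower.base by blast

lemma is_subfield_quadratic_closure:
  assumes F: "is_subfield F"
  shows "is_subfield (quadratic_closure F)"
  unfolding is_subfield_def
proof (intro conjI ballI)
  show "1 \<in> quadratic_closure F" using subset_quadratic_closure subfield_1[OF F] by blast
next
  fix x y assume "x \<in> quadratic_closure F" "y \<in> quadratic_closure F"
  then obtain K L where "quadratic_tower F K" "x \<in> K" "quadratic_tower F L" "y \<in> L"
    by (auto simp: quadratic_closure_def)
  then obtain M where "quadratic_tower F M" "x \<in> M" "y \<in> M"
    using quadratic_tower_directed[OF _ _ F] by blast
  then show "x - y \<in> quadratic_closure F" "x * y \<in> quadratic_closure F"
    using is_subfield_quadratic_tower[OF _ F] subfield_diff subfield_mult
    unfolding quadratic_closure_def by blast+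
next
  fix x assume "x \<in> quadratic_closure F"
  then show "inverse x \<in> quadratic_closure F"
    using is_subfield_quadratic_tower[OF _ F] subfield_inverse
    unfolding quadratic_closure_def by blast
qed

lemma sqrt_in_quadratic_closure:
  assumes F: "is_subfield F" and s: "s * s \<in> quadratic_closure F"
  shows "s \<in> quadratic_closure F"
proof -
  obtain K where K: "quadratic_tower F K" "s * s \<in> K"
    using s by (auto simp: quadratic_closure_def)
  show ?thesis
  proof (cases "s \<in> K")
    case False
    then have "quadratic_tower F (quadratic_extension K s)"
      using K by (intro quadratic_tower.step)
    then show ?thesis
      using generator_in_quadratic_extension is_subfield_quadratic_tower[OF K(1) F]
      unfolding quadratic_closure_def by blast
  qed (use K in \<open>auto simp: quadratic_closure_def\<close>)
qed

lemma odd_root_descends_quadratic_closure: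
  assumes "is_subfield F" "a \<in> F" "odd p" "g \<in> quadratic_closure F" "g ^ p = a"
  shows "\<exists>h\<in>F. h ^ p = a"
  using assms odd_root_descends_quadratic_tower unfolding quadratic_closure_def by blast

section \<open>Coordinates of constructible points\<close>

lemma affine_hull_2_through:
  fixes a b x :: "'a::real_vector"
  assumes "x \<in> affine hull {a, b}"
  shows "affine hull {a, b} = range (\<lambda>t. x + t *\<^sub>R (b - a))"
proof -
  obtain u where x: "x = a + u *\<^sub>R (b - a)"
    using assms by (auto simp: affine_hull_2_alt)
  show ?thesis
    unfolding affine_hull_2_alt
  proof (intro set_eqI iffI; clarify)
    fix t
    show "a + t *\<^sub>R (b - a) \<in> range (\<lambda>t. x + t *\<^sub>R (b - a))"
      by (rule range_eqI[of _ _ "t - u"]) (simp add: x algebra_simps)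
    show "x + t *\<^sub>R (b - a) \<in> range (\<lambda>t. a + t *\<^sub>R (b - a))"
      by (rule range_eqI[of _ _ "t + u"]) (simp add: x algebra_simps)
  qed
qed

text \<open>Proportional directions give the same line once both lines are based at the common point
  \<open>x\<close>. Contrapositively, distinct lines that meet have a nonzero determinant of
  directions.\<close>

lemma parallel_lines_meet_imp_eq:
  fixes a b c d x :: complex
  assumes "a \<noteq> b" "c \<noteq> d" and x: "x \<in> affine hull {a, b}" "x \<in> affine hull {c, d}"
    and par: "Re (b - a) * Im (d - c) = Im (b - a) * Re (d - c)"
  shows "affine hull {a, b} = affine hull {c, d}"
proof -
  obtain k where k: "d - c = k *\<^sub>R (b - a)"
  proof (cases "Re (b - a) = 0")
    case True
    then have "Im (b - a) \<noteq> 0" using \<open>a \<noteq> b\<close> by (simp add: complex_eq_iff)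
    with True par show ?thesis
      by (intro that[of "Im (d - c) / Im (b - a)"]) (auto simp: complex_eq_iff)
  next
    case False
    have "Im (d - c) = Re (d - c) / Re (b - a) * Im (b - a)"
      using par nonzero_mult_div_cancel_left[OF False, of "Im (d - c)"]
      by (simp add: mult.commute)
    with False show ?thesis
      by (intro that[of "Re (d - c) / Re (b - a)"]) (auto simp: complex_eq_iff)
  qed
  have "k \<noteq> 0" using k \<open>c \<noteq> d\<close> by auto
  have "range (\<lambda>t. x + t *\<^sub>R (b - a)) = range (\<lambda>t. x + t *\<^sub>R (d - c))"
  proof (intro set_eqI iffI; clarify)
    fix t
    show "x + t *\<^sub>R (b - a) \<in> range (\<lambda>t. x + t *\<^sub>R (d - c))"
      by (rule range_eqI[of _ _ "t / k"]) (use \<open>k \<noteq> 0\<close> in \<open>simp add: k\<close>)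
    show "x + t *\<^sub>R (d - c) \<in> range (\<lambda>t. x + t *\<^sub>R (b - a))"
      by (rule range_eqI[of _ _ "t * k"]) (simp add: k)
  qed
  then show ?thesis using x[THEN affine_hull_2_through] by simp
qed

lemma dist_complex_square: "(dist p q)\<^sup>2 = (Re p - Re q)\<^sup>2 + (Im p - Im q)\<^sup>2"
  by (simp add: dist_norm cmod_power2)

text \<open>Lines and circles through points with coordinates in \<open>V\<close> have equations
  over \<open>V\<close>, so intersecting them takes only field operations and real square
  roots.\<close>

lemma constructible_coordinates:
  fixes V :: "real set"
  assumes V: "is_subfield V" and sqrt: "\<And>t. t * t \<in> V \<Longrightarrow> t \<in> V"
    and S: "\<And>z. z \<in> S \<Longrightarrow> Re z \<in> V \<and> Im z \<in> V"
    and x: "x \<in> constructible S"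
  shows "Re x \<in> V \<and> Im x \<in> V"
  using x
proof induction
  case (base x)
  then show ?case using S by blast
next
  case (line_line a b c d x)
  obtain t s where t: "x = a + t *\<^sub>R (b - a)" and s: "x = c + s *\<^sub>R (d - c)"
    using line_line.hyps(8,9) unfolding affine_hull_2_alt by blast
  \<comment> \<open>Cramer's rule for the parameter \<open>t\<close> on the first line:
    \<open>t = E / D\<close>.\<close>
  define D where "D = Re (b - a) * Im (d - c) - Im (b - a) * Re (d - c)"
  define E where "E = Re (c - a) * Im (d - c) - Im (c - a) * Re (d - c)"
  have D0: "D \<noteq> 0" using parallel_lines_meet_imp_eq[of a b c d x] line_line by (auto simp: D_def)
  have "t *\<^sub>R (b - a) = (c - a) + s *\<^sub>R (d - c)" using t s by (simp add: algebra_simps)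
  then have "t * Re (b - a) = Re (c - a) + s * Re (d - c)"
    "t * Im (b - a) = Im (c - a) + s * Im (d - c)"
    by (simp_all add: complex_eq_iff)
  then have "t * D = E" unfolding D_def E_def by algebra
  then have "t = E / D" using D0 by (simp add: field_simps)
  moreover have "D \<in> V" "E \<in> V" unfolding D_def E_def minus_complex.sel
    using line_line by (auto intro!: subfield_closed[OF V])
  ultimately have "t \<in> V" using subfield_divide[OF V] by blast
  then show ?case using line_line t by (auto intro!: subfield_closed[OF V])
next
  case (line_circle a b c p q x)
  obtain t where t: "x = a + t *\<^sub>R (b - a)"
    using line_circle by (auto simp: affine_hull_2_alt)
  \<comment> \<open>Coefficients of the quadratic equation for \<open>t\<close> which says that
    \<open>x\<close> lies on the circle. Completing the square shows \<open>2 * A * t + B\<close> to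
    be a square root of the discriminant.\<close>
  define A where "A = (Re b - Re a)\<^sup>2 + (Im b - Im a)\<^sup>2"
  define B where "B = 2 * ((Re b - Re a) * (Re a - Re c) + (Im b - Im a) * (Im a - Im c))"
  define C where "C = (Re a - Re c)\<^sup>2 + (Im a - Im c)\<^sup>2 - ((Re p - Re q)\<^sup>2 + (Im p - Im q)\<^sup>2)"
  have V': "A \<in> V" "B \<in> V" "C \<in> V" unfolding A_def B_def C_def
    using line_circle by (auto intro!: subfield_closed[OF V])
  have "A \<noteq> 0" using \<open>a \<noteq> b\<close> by (auto simp: A_def complex_eq_iff sum_power2_eq_zero_iff)
  have "(dist x c)\<^sup>2 = (dist p q)\<^sup>2" using line_circle by (simp add: dist_commute)
  then have "A * t\<^sup>2 + B * t + C = 0"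
    unfolding dist_complex_square t A_def B_def C_def by (simp add: power2_eq_square algebra_simps)
  then have "(2 * A * t + B) * (2 * A * t + B) = B * B - 4 * A * C" by algebra
  also have "\<dots> \<in> V" using V' by (auto intro!: subfield_closed[OF V])
  finally have "2 * A * t + B \<in> V" by (rule sqrt)
  moreover have "t = (2 * A * t + B - B) / (2 * A)" using \<open>A \<noteq> 0\<close> by simp
  ultimately have "t \<in> V"
    using V' by (metis subfield_divide[OF V] subfield_diff[OF V] subfield_mult[OF V]
        subfield_numeral[OF V])
  then show ?case using line_circle t by (auto intro!: subfield_closed[OF V])
next
  case (circle_circle c p q c' p' q' x)
  \<comment> \<open>Concentric circles with a common point have equal radii and would
    coincide.\<close>
  have "c \<noteq> c'" using circle_circle by auto
  define u v where "u = Re c' - Re c" and "v = Im c' - Im c"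
  define y z where "y = Re x - Re c" and "z = Im x - Im c"
  define R where "R = (Re p - Re q)\<^sup>2 + (Im p - Im q)\<^sup>2"
  define R' where "R' = (Re p' - Re q')\<^sup>2 + (Im p' - Im q')\<^sup>2"
  define A where "A = u * u + v * v"
  \<comment> \<open>Subtracting the circle equations gives \<open>s\<close> as the scalar product of
    \<open>(u, v)\<close>, joining the centres, with \<open>(y, z)\<close>, pointing from
    \<open>c\<close> to \<open>x\<close>. The cross product \<open>w\<close> satisfies Lagrange's
    identity \<open>s * s + w * w = A * R\<close>, and \<open>s\<close> and \<open>w\<close>
    determine \<open>(y, z)\<close>.\<close>
  define s where "s = (R - R' + A) / 2"
  have V': "u \<in> V" "v \<in> V" "R \<in> V" "R' \<in> V" unfolding u_def v_def R_def R'_def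
    using circle_circle by (auto intro!: subfield_closed[OF V])
  then have A: "A \<in> V" unfolding A_def by (auto intro!: subfield_closed[OF V])
  then have s: "s \<in> V" unfolding s_def using V' by (auto intro!: subfield_closed[OF V])
  have "A \<noteq> 0" using \<open>c \<noteq> c'\<close>
    by (auto simp: A_def u_def v_def complex_eq_iff sum_squares_eq_zero_iff)
  have "(dist x c)\<^sup>2 = (dist p q)\<^sup>2" "(dist x c')\<^sup>2 = (dist p' q')\<^sup>2"
    using circle_circle by (simp_all add: dist_commute)
  then have 1: "y * y + z * z = R" and 2: "(y - u)\<^sup>2 + (z - v)\<^sup>2 = R'"
    unfolding dist_complex_square y_def z_def u_def v_def R_def R'_def
    by (simp_all add: power2_eq_square)
  have s_eq: "s = u * y + v * z"
    unfolding s_def A_def using 1 2 by (simp add: power2_eq_square field_simps)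
  define w where "w = u * z - v * y"
  have "w * w = A * R - s * s"
    unfolding w_def s_eq A_def 1[symmetric] by algebra
  also have "\<dots> \<in> V" using A s V' by (auto intro!: subfield_closed[OF V])
  finally have w: "w \<in> V" by (rule sqrt)
  have "y = (u * s - v * w) / A" "z = (v * s + u * w) / A"
    using \<open>A \<noteq> 0\<close> by (simp_all add: field_simps s_eq w_def A_def)
  then have "y \<in> V" "z \<in> V" using V' A s w by (auto intro!: subfield_closed[OF V])
  moreover have "Re x = Re c + y" "Im x = Im c + z" by (simp_all add: y_def z_def)
  ultimately show ?case using circle_circle subfield_add[OF V] by auto
qed

section \<open>Integer polynomials and the field generated by one number\<close>

definition int_polys :: "'a::field_char_0 poly set" where
  "int_polys = {f. \<forall>i. coeff f i \<in> \<int>}"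

lemma int_polys_pCons_iff: "pCons c f \<in> int_polys \<longleftrightarrow> c \<in> \<int> \<and> f \<in> int_polys"
  by (auto simp: int_polys_def coeff_pCons split: nat.splits)

lemma int_polys_0: "0 \<in> int_polys"
  by (simp add: int_polys_def)

lemma int_polys_add: "f \<in> int_polys \<Longrightarrow> g \<in> int_polys \<Longrightarrow> f + g \<in> int_polys"
  by (simp add: int_polys_def)

lemma int_polys_diff: "f \<in> int_polys \<Longrightarrow> g \<in> int_polys \<Longrightarrow> f - g \<in> int_polys"
  by (simp add: int_polys_def)

lemma int_polys_mult: "f \<in> int_polys \<Longrightarrow> g \<in> int_polys \<Longrightarrow> f * g \<in> int_polys"
  by (auto simp: int_polys_def coeff_mult intro!: Ints_sum Ints_mult)

lemma int_polys_1: "1 \<in> int_polys"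
  by (simp add: one_pCons int_polys_pCons_iff int_polys_0)

lemma int_polys_power: "f \<in> int_polys \<Longrightarrow> f ^ n \<in> int_polys"
  by (induction n) (simp_all add: int_polys_1 int_polys_mult)

lemmas int_polys_closed = int_polys_0 int_polys_1 int_polys_add int_polys_diff int_polys_mult
  int_polys_power

lemma algebraic_iff_int_polys: "algebraic x \<longleftrightarrow> (\<exists>f\<in>int_polys. f \<noteq> 0 \<and> poly f x = 0)"
  by (auto simp: algebraic_def int_polys_def)

text \<open>This is the field generated by \<open>x\<close> over the rationals, also for algebraic
  \<open>x\<close>. Clearing denominators allows integer coefficients, the form in which
  \<open>algebraic\<close> is stated.\<close>

definition rational_functions_at :: "'a::field_char_0 \<Rightarrow> 'a set" where
  "rational_functions_at x =
     {poly f x / poly g x | f g. f \<in> int_polys \<and> g \<in> int_polys \<and> poly g x \<noteq> 0}"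

lemma rational_functions_atI:
  "f \<in> int_polys \<Longrightarrow> g \<in> int_polys \<Longrightarrow> poly g x \<noteq> 0 \<Longrightarrow> y = poly f x / poly g x \<Longrightarrow>
     y \<in> rational_functions_at x"
  by (auto simp: rational_functions_at_def)

lemma is_subfield_rational_functions_at: "is_subfield (rational_functions_at x)"
  unfolding is_subfield_def
proof (intro conjI ballI)
  show "1 \<in> rational_functions_at x"
    by (rule rational_functions_atI[of 1 1]) (simp_all add: int_polys_closed)
next
  fix u v assume "u \<in> rational_functions_at x" "v \<in> rational_functions_at x"
  then obtain f g h k where *: "f \<in> int_polys" "g \<in> int_polys" "h \<in> int_polys" "k \<in> int_polys"
    "poly g x \<noteq> 0" "poly k x \<noteq> 0" "u = poly f x / poly g x" "v = poly h x / poly k x"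
    by (auto simp: rational_functions_at_def)
  show "u - v \<in> rational_functions_at x"
    by (rule rational_functions_atI[of "f * k - h * g" "g * k"])
      (use * in \<open>simp_all add: int_polys_closed diff_frac_eq\<close>)
  show "u * v \<in> rational_functions_at x"
    by (rule rational_functions_atI[of "f * h" "g * k"])
      (use * in \<open>simp_all add: int_polys_closed\<close>)
next
  fix u assume "u \<in> rational_functions_at x"
  then obtain f g where *: "f \<in> int_polys" "g \<in> int_polys" "poly g x \<noteq> 0"
    "u = poly f x / poly g x"
    by (auto simp: rational_functions_at_def)
  show "inverse u \<in> rational_functions_at x"
  proof (cases "poly f x = 0")
    case True
    show ?thesis
      by (rule rational_functions_atI[of 0 1]) (use * True in \<open>simp_all add: int_polys_closed\<close>)
  next
    case False
    show ?thesis by (rule rational_functions_atI[of g f]) (use * False in simp_all)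
  qed
qed

lemma self_in_rational_functions_at: "x \<in> rational_functions_at x"
  by (rule rational_functions_atI[of "[:0, 1:]" 1])
    (simp_all add: int_polys_closed int_polys_pCons_iff)

lemma root_in_rational_functions_at_imp_algebraic:
  assumes h: "h \<in> rational_functions_at x" "h ^ p = x" and p: "p \<noteq> 1"
  shows "algebraic x"
proof (rule ccontr)
  assume na: "\<not> algebraic x"
  obtain f g where fg: "f \<in> int_polys" "g \<in> int_polys" "poly g x \<noteq> 0" "h = poly f x / poly g x"
    using h by (auto simp: rational_functions_at_def)
  have "poly f x ^ p = x * poly g x ^ p"
    using h(2) fg(3) unfolding fg(4) by (simp add: power_divide divide_eq_eq)
  then have "poly (f ^ p - [:0, 1:] * g ^ p) x = 0" by simp
  moreover have "f ^ p - [:0, 1:] * g ^ p \<in> int_polys"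
    using fg by (intro int_polys_closed) (simp_all add: int_polys_pCons_iff int_polys_0)
  \<comment> \<open>For transcendental \<open>x\<close>, equality of the values at \<open>x\<close>
    is equality of polynomials, so degrees can be compared modulo \<open>p\<close>.\<close>
  ultimately have eq: "f ^ p = [:0, 1:] * g ^ p"
    using na by (auto simp: algebraic_iff_int_polys)
  have "g \<noteq> 0" using fg by auto
  then have "degree ([:0, 1:] * g ^ p) = 1 + p * degree g"
    by (subst degree_mult_eq) (auto simp: degree_power_eq)
  \<comment> \<open>For \<open>p = 0\<close> the equation reads \<open>1 = X\<close>, which is
    absurd.\<close>
  moreover have "f \<noteq> 0"
    using eq \<open>g \<noteq> 0\<close> by (cases "p = 0") (auto simp: one_pCons zero_power)
  ultimately have "p * degree f = 1 + p * degree g" using eq by (metis degree_power_eq)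
  then have "p dvd 1" by (metis dvd_add_left_iff dvd_triv_left)
  then show False using p by simp
qed

section \<open>Symmetric expressions in z and 1/z\<close>

lemma symmetric_sum_poly:
  fixes h :: "'a::field_char_0 poly"
  assumes "h \<in> int_polys"
  shows "\<exists>A\<in>int_polys. \<exists>B\<in>int_polys. \<forall>z. z \<noteq> 0 \<longrightarrow>
    poly h z + poly h (inverse z) = poly A (z + inverse z) \<and>
    z * poly h z + inverse z * poly h (inverse z) = poly B (z + inverse z)"
  using assms
proof (induction h)
  case 0
  show ?case by (rule bexI[of _ 0], rule bexI[of _ 0]) (auto simp: int_polys_closed)
next
  case (pCons c h)
  then obtain A B where AB: "A \<in> int_polys" "B \<in> int_polys" and
    eq: "\<And>z. z \<noteq> 0 \<Longrightarrow> poly h z + poly h (inverse z) = poly A (z + inverse z)"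
      "\<And>z. z \<noteq> 0 \<Longrightarrow> z * poly h z + inverse z * poly h (inverse z) = poly B (z + inverse z)"
    by (auto simp: int_polys_pCons_iff)
  have c: "c \<in> \<int>" using pCons by (simp add: int_polys_pCons_iff)
  show ?case
  proof (intro bexI allI impI conjI)
    \<comment> \<open>Put \<open>w = z + 1/z\<close>. For \<open>c + X * h\<close> the plain sum is
      \<open>2 * c + B(w)\<close> and the weighted sum is \<open>c * w + w * B(w) - A(w)\<close>.
      Each refers to the other, so the induction carries both.\<close>
    show "[:0, c:] + [:0, 1:] * B - A \<in> int_polys" "[:c + c:] + B \<in> int_polys"
      by (intro int_polys_closed AB; use c in \<open>simp add: int_polys_pCons_iff int_polys_0\<close>)+
  next
    fix z :: 'a assume z: "z \<noteq> 0"
    show "poly (pCons c h) z + poly (pCons c h) (inverse z) = poly ([:c + c:] + B) (z + inverse z)"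
      using eq(2)[OF z] by simp
    have "z * inverse z = 1" using z by simp
    then show "z * poly (pCons c h) z + inverse z * poly (pCons c h) (inverse z)
        = poly ([:0, c:] + [:0, 1:] * B - A) (z + inverse z)"
      unfolding poly_add poly_diff poly_mult poly_pCons poly_0 eq[OF z, symmetric] by algebra
  qed
qed

text \<open>The product for \<open>c + X * f\<close> expands to \<open>c * c\<close>, plus the
  product for \<open>f\<close>, plus \<open>c\<close> times the weighted sum of
  \<open>symmetric_sum_poly\<close>.\<close>

lemma symmetric_product_poly:
  fixes f :: "'a::field_char_0 poly"
  assumes "f \<in> int_polys"
  shows "\<exists>G\<in>int_polys. \<forall>z. z \<noteq> 0 \<longrightarrow> poly f z * poly f (inverse z) = poly G (z + inverse z)"
  using assms
proof (induction f)
  case 0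
  show ?case by (rule bexI[of _ 0]) (auto simp: int_polys_closed)
next
  case (pCons c f)
  then have c: "c \<in> \<int>" and f: "f \<in> int_polys" by (simp_all add: int_polys_pCons_iff)
  obtain G where G: "G \<in> int_polys"
    "\<And>z. z \<noteq> 0 \<Longrightarrow> poly f z * poly f (inverse z) = poly G (z + inverse z)"
    using pCons f by blast
  obtain B where B: "B \<in> int_polys"
    "\<And>z. z \<noteq> 0 \<Longrightarrow> z * poly f z + inverse z * poly f (inverse z) = poly B (z + inverse z)"
    using symmetric_sum_poly[OF f] by blast
  show ?case
  proof (intro bexI allI impI)
    show "[:c * c:] + G + [:c:] * B \<in> int_polys"
      by (intro int_polys_closed G(1) B(1); use c in \<open>simp add: int_polys_pCons_iff int_polys_0\<close>)
  next
    fix z :: 'a assume z: "z \<noteq> 0"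
    have "z * inverse z = 1" using z by simp
    then show "poly (pCons c f) z * poly (pCons c f) (inverse z)
        = poly ([:c * c:] + G + [:c:] * B) (z + inverse z)"
      unfolding poly_add poly_mult poly_pCons poly_0 G(2)[OF z, symmetric] B(2)[OF z, symmetric]
      by algebra
  qed
qed

lemma algebraic_add_inverse:
  fixes x :: "'a::field_char_0"
  assumes "algebraic x" "x \<noteq> 0"
  shows "algebraic (x + inverse x)"
proof -
  obtain f where f: "f \<in> int_polys" "f \<noteq> 0" "poly f x = 0"
    using assms by (auto simp: algebraic_iff_int_polys)
  obtain G where G: "G \<in> int_polys"
    "\<And>z. z \<noteq> 0 \<Longrightarrow> poly f z * poly f (inverse z) = poly G (z + inverse z)"
    using symmetric_product_poly[OF f(1)] by blast
  \<comment> \<open>Otherwise every nonzero \<open>z\<close> would be a root of \<open>f\<close> or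
    the inverse of one, but \<open>f\<close> has only finitely many roots.\<close>
  have "G \<noteq> 0"
  proof
    assume "G = 0"
    then have "poly f z = 0 \<or> poly f (inverse z) = 0" if "z \<noteq> 0" for z
      using G(2)[OF that] by simp
    then have "UNIV \<subseteq> {0} \<union> {z. poly f z = 0} \<union> inverse ` {z. poly f z = 0}"
      by (auto simp: image_iff) (metis inverse_inverse_eq)
    moreover have "finite {z. poly f z = 0}" using f(2) by (rule poly_roots_finite)
    ultimately show False using infinite_UNIV_char_0 finite_subset by blast
  qed
  then show ?thesis using G(2)[OF assms(2)] G(1) f(3) by (auto simp: algebraic_iff_int_polys)
qed

text \<open>Substituting \<open>2 * X\<close> for \<open>X\<close> keeps the coefficients
  integral.\<close>

lemma algebraic_half:
  fixes x :: "'a::field_char_0"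
  assumes "algebraic (2 * x)"
  shows "algebraic x"
proof -
  obtain f where f: "f \<in> int_polys" "f \<noteq> 0" "poly f (2 * x) = 0"
    using assms by (auto simp: algebraic_iff_int_polys)
  have "pcompose f [:0, 2:] \<noteq> 0" using f(2) by (simp add: pcompose_eq_0_iff)
  moreover have "pcompose g [:0, 2:] \<in> int_polys" if "g \<in> int_polys" for g :: "'a poly"
    using that
  proof (induction g)
    case (pCons c g)
    then have "c \<in> \<int>" "pcompose g [:0, 2:] \<in> int_polys" by (simp_all add: int_polys_pCons_iff)
    then show ?case unfolding pcompose_pCons
      by (intro int_polys_closed) (simp_all add: int_polys_pCons_iff int_polys_0)
  qed (simp add: int_polys_0)
  moreover have "poly (pcompose f [:0, 2:]) x = 0" using f(3) by (simp add: poly_pcompose mult.commute)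
  ultimately show ?thesis using f(1) by (auto simp: algebraic_iff_int_polys)
qed

section \<open>Algebraicity of the cosine of a sectable angle\<close>

lemma angle_add_inverse:
  assumes "is_angle \<alpha>"
  shows "\<alpha> + inverse \<alpha> = 2 * of_real (Re \<alpha>)" "\<alpha> - inverse \<alpha> = 2 * \<i> * of_real (Im \<alpha>)"
proof -
  have "\<alpha> * cnj \<alpha> = 1" using assms by (simp add: is_angle_def flip: complex_norm_square)
  then have "inverse \<alpha> = cnj \<alpha>" by (rule inverse_unique)
  then show "\<alpha> + inverse \<alpha> = 2 * of_real (Re \<alpha>)" "\<alpha> - inverse \<alpha> = 2 * \<i> * of_real (Im \<alpha>)"
    by (simp_all add: complex_eq_iff)
qed

text \<open>The coordinates of \<open>\<alpha>\<close> lie in the closure because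
  \<open>inverse \<alpha>\<close> is the conjugate of \<open>\<alpha>\<close> and
  \<open>\<i>\<close> is a square root of -1.\<close>

lemma constructible_in_quadratic_closure:
  assumes \<alpha>: "is_angle \<alpha>" and \<beta>: "\<beta> \<in> constructible {0, 1, \<alpha>}"
  shows "\<beta> \<in> quadratic_closure (rational_functions_at \<alpha>)"
proof -
  define Q where "Q = quadratic_closure (rational_functions_at \<alpha>)"
  note F = is_subfield_rational_functions_at[of \<alpha>]
  have Q: "is_subfield Q" unfolding Q_def by (rule is_subfield_quadratic_closure[OF F])
  have sqrtQ: "s \<in> Q" if "s * s \<in> Q" for s
    using that unfolding Q_def by (rule sqrt_in_quadratic_closure[OF F])
  have i: "\<i> \<in> Q"
    using sqrtQ[of \<i>] subfield_minus[OF Q subfield_1[OF Q]] unfolding i_squared by blast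
  have \<alpha>Q: "\<alpha> \<in> Q"
    using self_in_rational_functions_at subset_quadratic_closure unfolding Q_def by blast
  \<comment> \<open>Coordinates are real while the towers are complex. The reals contained in
    \<open>Q\<close> form a subfield closed under real square roots, as
    \<open>constructible_coordinates\<close> requires.\<close>
  define V where "V = {t. complex_of_real t \<in> Q}"
  have V: "is_subfield V"
    unfolding is_subfield_def V_def
    by (simp add: subfield_1[OF Q] subfield_diff[OF Q] subfield_mult[OF Q] subfield_inverse[OF Q])
  have sqrtV: "t \<in> V" if "t * t \<in> V" for t
    using that sqrtQ[of "of_real t"] by (simp add: V_def)
  have "complex_of_real (Re \<alpha>) = (\<alpha> + inverse \<alpha>) / 2"
    "complex_of_real (Im \<alpha>) = (\<alpha> - inverse \<alpha>) / (2 * \<i>)"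
    using angle_add_inverse[OF \<alpha>] by simp_all
  moreover have "(\<alpha> + inverse \<alpha>) / 2 \<in> Q" "(\<alpha> - inverse \<alpha>) / (2 * \<i>) \<in> Q"
    by (intro subfield_closed[OF Q] \<alpha>Q i)+
  ultimately have "Re \<alpha> \<in> V" "Im \<alpha> \<in> V"
    by (simp_all only: V_def mem_Collect_eq)
  then have "Re \<beta> \<in> V \<and> Im \<beta> \<in> V"
    by (intro constructible_coordinates[OF V sqrtV _ \<beta>]) (auto simp: subfield_closed[OF V])
  then have "of_real (Re \<beta>) + \<i> * of_real (Im \<beta>) \<in> Q"
    using i by (auto simp: V_def intro!: subfield_closed[OF Q])
  then show ?thesis by (simp add: Q_def flip: complex_eq)
qed

lemma sectable_imp_algebraic:
  assumes "m > 0" "\<nexists>k. m = 2 ^ k" and \<alpha>: "is_angle \<alpha>" "sectable m \<alpha>"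
  shows "algebraic (Re \<alpha>)"
proof -
  \<comment> \<open>\<open>p\<close> is the odd part of \<open>m\<close>; it differs from 1 because
    \<open>m\<close> is not a power of two.\<close>
  obtain k p where kp: "m = 2 ^ k * p" "odd p"
    using \<open>m > 0\<close> multiplicity_decompose'[of m 2] by (metis bot_nat_0.not_eq_extremum odd_one)
  then have "p \<noteq> 1" using assms(2) by auto
  note F = is_subfield_rational_functions_at[of \<alpha>]
  obtain \<beta> where \<beta>: "\<beta> ^ m = \<alpha>" "\<beta> \<in> constructible {0, 1, \<alpha>}"
    using \<alpha>(2) by (auto simp: sectable_def)
  have "\<beta> ^ (2 ^ k) \<in> quadratic_closure (rational_functions_at \<alpha>)"
    using subfield_power[OF is_subfield_quadratic_closure[OF F]]
      constructible_in_quadratic_closure[OF \<alpha>(1) \<beta>(2)] by blast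
  moreover have "(\<beta> ^ (2 ^ k)) ^ p = \<alpha>" using \<beta> kp by (simp add: power_mult)
  ultimately obtain h where "h \<in> rational_functions_at \<alpha>" "h ^ p = \<alpha>"
    using odd_root_descends_quadratic_closure[OF F self_in_rational_functions_at kp(2)] by blast
  then have "algebraic \<alpha>" using \<open>p \<noteq> 1\<close> by (rule root_in_rational_functions_at_imp_algebraic)
  moreover have "\<alpha> \<noteq> 0" using \<alpha> by (auto simp: is_angle_def)
  ultimately have "algebraic (2 * complex_of_real (Re \<alpha>))"
    using algebraic_add_inverse angle_add_inverse(1)[OF \<alpha>(1)] by metis
  then show ?thesis using algebraic_half algebraic_of_real_iff by blast
qed

section \<open>Bisection with straightedge and compass\<close>

lemma sphere_neq_if_center_neq:
  fixes c c' :: "'a::real_normed_vector"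
  assumes "c \<noteq> c'" "r \<ge> 0"
  shows "sphere c r \<noteq> sphere c' r"
proof -
  define n where "n = norm (c - c')"
  \<comment> \<open>The point of the first sphere farthest from \<open>c'\<close>: its distance from
    \<open>c'\<close> is \<open>n + r\<close>, which exceeds \<open>r\<close>.\<close>
  define x where "x = c + (r / n) *\<^sub>R (c - c')"
  have n: "n > 0" using assms by (simp add: n_def)
  have "x - c' = (1 + r / n) *\<^sub>R (c - c')" by (simp add: x_def algebra_simps)
  then have "norm (x - c') = \<bar>1 + r / n\<bar> * n" by (simp add: n_def)
  also have "\<dots> = n + r" using n assms by (simp add: abs_of_nonneg field_simps)
  finally have "x \<notin> sphere c' r" using n by (simp add: dist_norm norm_minus_commute)
  moreover have "x \<in> sphere c r" using n assms by (simp add: x_def dist_norm flip: n_def)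
  ultimately show ?thesis by blast
qed

text \<open>The angle need only be constructible over \<open>S\<close>, so bisection can be repeated
  over one fixed starting set.\<close>

lemma angle_sqrt_constructible:
  assumes T: "0 \<in> constructible S" "1 \<in> constructible S" and \<alpha>: "\<alpha> \<in> constructible S" "is_angle \<alpha>"
  shows "\<exists>\<beta>\<in>constructible S. is_angle \<beta> \<and> \<beta>\<^sup>2 = \<alpha>"
proof -
  \<comment> \<open>The line through 0 and \<open>z\<close> meets the unit circle in
    \<open>z / |z|\<close>.\<close>
  have unit: "z /\<^sub>R cmod z \<in> constructible S" if "z \<in> constructible S" "z \<noteq> 0" for z
  proof (rule constructible.line_circle[of 0 S z 0 0 1])
    show "z /\<^sub>R cmod z \<in> affine hull {0, z}"
      unfolding affine_hull_2_alt by (rule range_eqI[of _ _ "inverse (cmod z)"]) simp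
  qed (use that T in auto)
  consider "\<alpha> = 1" | "\<alpha> = -1" | "\<alpha> \<noteq> 1" "\<alpha> \<noteq> -1" by blast
  then show ?thesis
  proof cases
    case 1
    then show ?thesis using T by (intro bexI[of _ 1]) (auto simp: is_angle_def)
  next
    case 2
    \<comment> \<open>Here \<open>1 + \<alpha>\<close> is 0 and gives no direction. The apex of an
      equilateral triangle over -1 and 1, of side 2, lies on the imaginary axis.\<close>
    define z where "z = \<i> * sqrt 3"
    have "cmod (1 - z) = 2" "cmod (-1 - z) = 2" by (simp_all add: z_def cmod_def)
    then have "z \<in> constructible S"
      using constructible.circle_circle[of 1 S 1 "-1" "-1" 1 "-1" z] 2 \<alpha> T
      by (auto simp: dist_norm sphere_neq_if_center_neq)
    then have "z /\<^sub>R cmod z \<in> constructible S" by (rule unit) (simp add: z_def)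
    moreover have "z /\<^sub>R cmod z = \<i>" by (simp add: z_def norm_mult complex_eq_iff)
    ultimately show ?thesis using 2 by (intro bexI[of _ \<i>]) (auto simp: is_angle_def)
  next
    case 3
    have n: "cmod \<alpha> = 1" using \<alpha> by (simp add: is_angle_def)
    \<comment> \<open>The fourth vertex of the rhombus is the common point, other than 0, of the
      unit circles about 1 and \<open>\<alpha>\<close>.\<close>
    define z where "z = 1 + \<alpha>"
    have "z \<noteq> 0" using 3 by (auto simp: z_def add_eq_0_iff)
    have "z \<in> constructible S"
      using constructible.circle_circle[of 1 S 0 1 \<alpha> 0 1 z] 3 \<alpha> T n
      by (auto simp: dist_norm z_def sphere_neq_if_center_neq)
    then have "z /\<^sub>R cmod z \<in> constructible S" using \<open>z \<noteq> 0\<close> by (rule unit)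
    moreover have "(z /\<^sub>R cmod z)\<^sup>2 = \<alpha>"
    proof -
      have "\<alpha> * cnj \<alpha> = 1" using n by (simp flip: complex_norm_square)
      \<comment> \<open>Multiplying \<open>cnj z = 1 + cnj \<alpha>\<close> by
        \<open>\<alpha>\<close> gives \<open>z\<close>. So the square of \<open>z\<close> is
        \<open>\<alpha>\<close> times the positive number \<open>z * cnj z\<close>, which
        normalisation removes.\<close>
      then have "z\<^sup>2 = \<alpha> * (z * cnj z)" unfolding z_def complex_cnj_add complex_cnj_one by algebra
      also have "z * cnj z = (of_real (cmod z))\<^sup>2" by (simp flip: complex_norm_square)
      finally show ?thesis using \<open>z \<noteq> 0\<close>
        by (simp add: scaleR_conv_of_real power_mult_distrib field_simps)
    qed
    ultimately show ?thesis using \<open>z \<noteq> 0\<close>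
      by (intro bexI[of _ "z /\<^sub>R cmod z"]) (auto simp: is_angle_def)
  qed
qed

lemma sectable_power_of_two:
  assumes "is_angle \<alpha>"
  shows "sectable (2 ^ k) \<alpha>"
proof (induction k)
  case 0
  show ?case unfolding sectable_def using assms by (auto intro: constructible.base)
next
  case (Suc k)
  then obtain \<beta> where \<beta>: "is_angle \<beta>" "\<beta> ^ 2 ^ k = \<alpha>" "\<beta> \<in> constructible {0, 1, \<alpha>}"
    by (auto simp: sectable_def)
  obtain \<gamma> where "\<gamma> \<in> constructible {0, 1, \<alpha>}" "is_angle \<gamma>" "\<gamma>\<^sup>2 = \<beta>"
    using angle_sqrt_constructible[OF _ _ \<beta>(3,1)] by (auto intro: constructible.base)
  then show ?case using \<beta>(2) unfolding sectable_def by (auto simp: power_mult)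
qed

section \<open>The range of cosines, and the theorem\<close>

lemma Re_angle_iff: "(\<exists>\<alpha>. is_angle \<alpha> \<and> Re \<alpha> = x) \<longleftrightarrow> x \<in> {-1..1}"
proof
  assume "\<exists>\<alpha>. is_angle \<alpha> \<and> Re \<alpha> = x"
  then obtain \<alpha> where "cmod \<alpha> = 1" "Re \<alpha> = x" by (auto simp: is_angle_def)
  then show "x \<in> {-1..1}" using abs_Re_le_cmod[of \<alpha>] by auto
next
  assume "x \<in> {-1..1}"
  then have "is_angle (cis (arccos x)) \<and> Re (cis (arccos x)) = x" by (simp add: is_angle_def)
  then show "\<exists>\<alpha>. is_angle \<alpha> \<and> Re \<alpha> = x" by blast
qed

theorem theorem1p1:
  fixes m :: nat
  assumes "m > 0"
  shows "((\<exists>k. m = 2 ^ k) \<longrightarrow>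
            (\<forall>\<alpha>. is_angle \<alpha> \<longrightarrow> sectable m \<alpha>) \<and>
            {Re \<alpha> | \<alpha>. is_angle \<alpha> \<and> sectable m \<alpha>} = {-1..1}) \<and>
         ((\<nexists>k. m = 2 ^ k) \<longrightarrow>
            (\<forall>\<alpha>. is_angle \<alpha> \<and> sectable m \<alpha> \<longrightarrow>
                  algebraic (Re \<alpha>) \<and> Re \<alpha> \<in> {-1..1}))"
proof (intro conjI impI)
  assume "\<exists>k. m = 2 ^ k"
  then show all: "\<forall>\<alpha>. is_angle \<alpha> \<longrightarrow> sectable m \<alpha>" using sectable_power_of_two by blast
  show "{Re \<alpha> | \<alpha>. is_angle \<alpha> \<and> sectable m \<alpha>} = {-1..1}"
    unfolding set_eq_iff Re_angle_iff[symmetric] using all by blast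
next
  assume "\<nexists>k. m = 2 ^ k"
  then show "\<forall>\<alpha>. is_angle \<alpha> \<and> sectable m \<alpha> \<longrightarrow> algebraic (Re \<alpha>) \<and> Re \<alpha> \<in> {-1..1}"
    using sectable_imp_algebraic[OF assms] Re_angle_iff by blast
qed

end
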